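(* For every positive integer $n$, the dihedral group $D_{2n}=\langle x,y \mid x^n=y^2=1,\ x^y=x^{-1}\rangle$ of order $2n$ satisfies $$\kappa(D_{2n})=\kappa(\mathbb{Z}_n).$$
   Context: For a finite group $G$, the power graph $\mathcal{P}(G)$ is the simple undirected graph whose vertices are the elements of $G$, two distinct vertices $x,y$ being adjacent iff $\langle x\rangle\subseteq\langle y\rangle$ or $\langle y\rangle\subseteq\langle x\rangle$. $\kappa(G)$ denotes the number of spanning trees of $\mathcal{P}(G)$. $\mathbb{Z}_n$ is the cyclic group of order $n$, and $x^y=y^{-1}xy$. *)

theory Defs
  imports
    "HOL-Algebra.Elementary_Groups"
    "HOL-Algebra.Coset"
    "HOL-Number_Theory.Cong"
    "Graph_Theory.Digraph_Component"
begin

section \<open>Spanning trees and power graphs\<close>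

text \<open>
  As in the AFP entry, a simple undirected graph is a symmetric digraph without loops and multiple
  arcs (locale \<^locale>\<open>graph\<close>); an undirected edge is a pair of opposite arcs.  The constants
  \<^const>\<open>Digraph_Component.forest\<close> and \<^const>\<open>Digraph_Component.spanning_tree\<close> cannot be used
  for such graphs, because there the walk that traverses an edge back and forth counts as a cycle.
  In an undirected simple graph a cycle has at least three edges.
\<close>

definition undirected_spanning_tree :: "('a, 'b) pre_digraph \<Rightarrow> ('a, 'b) pre_digraph \<Rightarrow> bool" where
  "undirected_spanning_tree T G \<longleftrightarrow>
     spanning T G \<and> symmetric T \<and> Digraph_Component.connected T \<and>
     \<not> (\<exists>p. pre_digraph.cycle T p \<and> 3 \<le> length p)"

definition power_graph :: "('a, 'm) monoid_scheme \<Rightarrow> ('a, 'a \<times> 'a) pre_digraph" where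
  "power_graph G = with_proj
     \<lparr> pverts = carrier G,
       parcs = {(x, y). x \<in> carrier G \<and> y \<in> carrier G \<and> x \<noteq> y \<and>
                  (generate G {x} \<subseteq> generate G {y} \<or> generate G {y} \<subseteq> generate G {x})} \<rparr>"

definition kappa :: "('a, 'm) monoid_scheme \<Rightarrow> nat" (\<open>\<kappa>\<close>) where
  "\<kappa> G = card {T. undirected_spanning_tree T (power_graph G)}"

lemma graph_power_graph:
  assumes "finite (carrier G)"
  shows "graph (power_graph G)"
proof -
  let ?P = "\<lparr> pverts = carrier G,
       parcs = {(x, y). x \<in> carrier G \<and> y \<in> carrier G \<and> x \<noteq> y \<and>
                  (generate G {x} \<subseteq> generate G {y} \<or> generate G {y} \<subseteq> generate G {x})} \<rparr>"
  have "finite (parcs ?P)"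
    by (rule finite_subset[of _ "carrier G \<times> carrier G"]) (use assms in auto)
  then have "pair_graph ?P"
    using assms by unfold_locales (auto simp: symmetric_def intro!: symI)
  then show ?thesis
    unfolding power_graph_def by (rule pair_graph.pair_graphD_graph)
qed


section \<open>Groups given by generators and relations\<close>

datatype 'g letter = Gen 'g | Inv 'g

text \<open>
  \<open>word_equiv R\<close> is the least congruence on the words in the letters \<open>g\<close> and \<open>g\<^sup>-\<^sup>1\<close> that makes
  \<open>g\<^sup>-\<^sup>1\<close> inverse to \<open>g\<close> and identifies \<open>l\<close> with \<open>r\<close> for each relation \<open>l = r\<close>, i.e. each
  pair \<open>(l, r)\<close> in \<open>R\<close>.
\<close>

inductive word_equiv :: "('g letter list \<times> 'g letter list) set \<Rightarrow> 'g letter list \<Rightarrow> 'g letter list \<Rightarrow> bool"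
  for R where
  refl: "word_equiv R u u"
| sym: "word_equiv R u v \<Longrightarrow> word_equiv R v u"
| trans: "word_equiv R u v \<Longrightarrow> word_equiv R v w \<Longrightarrow> word_equiv R u w"
| Gen_Inv: "word_equiv R (u @ [Gen g, Inv g] @ v) (u @ v)"
| Inv_Gen: "word_equiv R (u @ [Inv g, Gen g] @ v) (u @ v)"
| rel: "(l, r) \<in> R \<Longrightarrow> word_equiv R (u @ l @ v) (u @ r @ v)"

definition word_class :: "('g letter list \<times> 'g letter list) set \<Rightarrow> 'g letter list \<Rightarrow> 'g letter list set" where
  "word_class R u = {v. word_equiv R u v}"

definition presented_group :: "('g letter list \<times> 'g letter list) set \<Rightarrow> 'g letter list set monoid" where
  "presented_group R =
     \<lparr> carrier = range (word_class R),
       monoid.mult = (\<lambda>A B. \<Union>u\<in>A. \<Union>v\<in>B. word_class R (u @ v)),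
       one = word_class R [] \<rparr>"

lemma word_equiv_append1: "word_equiv R u u' \<Longrightarrow> word_equiv R (a @ u @ b) (a @ u' @ b)"
proof (induction rule: word_equiv.induct)
  case (Gen_Inv u g v)
  show ?case using word_equiv.Gen_Inv[of R "a @ u" g "v @ b"] by simp
next
  case (Inv_Gen u g v)
  show ?case using word_equiv.Inv_Gen[of R "a @ u" g "v @ b"] by simp
next
  case (rel l r u v)
  show ?case using word_equiv.rel[OF rel, of "a @ u" "v @ b"] by simp
qed (blast intro: word_equiv.intros)+

lemma word_equiv_append:
  assumes "word_equiv R u u'" "word_equiv R v v'"
  shows "word_equiv R (u @ v) (u' @ v')"
  using word_equiv_append1[OF assms(1), of "[]" v] word_equiv_append1[OF assms(2), of u' "[]"]
  by (auto intro: word_equiv.trans)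

lemma word_class_eq_iff: "word_class R u = word_class R v \<longleftrightarrow> word_equiv R u v"
  unfolding word_class_def by (blast intro: word_equiv.intros)

lemma presented_group_simps:
  shows carrier_presented_group: "carrier (presented_group R) = range (word_class R)"
    and one_presented_group: "\<one>\<^bsub>presented_group R\<^esub> = word_class R []"
    and mult_presented_group:
      "word_class R u \<otimes>\<^bsub>presented_group R\<^esub> word_class R v = word_class R (u @ v)"
proof -
  have eq: "word_class R (u' @ v') = word_class R (u @ v)"
    if "u' \<in> word_class R u" "v' \<in> word_class R v" for u' v'
    using word_equiv.sym[OF word_equiv_append[of R u u' v v']] that
    by (simp add: word_class_eq_iff) (simp add: word_class_def)
  have ne: "word_class R w \<noteq> {}" for w
    using word_equiv.refl[of R w] by (auto simp: word_class_def)
  have "(\<Union>u'\<in>word_class R u. \<Union>v'\<in>word_class R v. word_class R (u' @ v')) =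
        (\<Union>u'\<in>word_class R u. \<Union>v'\<in>word_class R v. word_class R (u @ v))"
    by (intro SUP_cong HOL.refl eq)
  also have "\<dots> = word_class R (u @ v)"
    by (simp only: UN_constant ne if_False)
  finally show "word_class R u \<otimes>\<^bsub>presented_group R\<^esub> word_class R v = word_class R (u @ v)"
    by (simp only: presented_group_def monoid.simps)
qed (simp_all add: presented_group_def)

primrec letter_inv :: "'g letter \<Rightarrow> 'g letter" where
  "letter_inv (Gen g) = Inv g"
| "letter_inv (Inv g) = Gen g"

lemma word_equiv_inv: "word_equiv R (rev (map letter_inv u) @ u) []"
proof (induction u)
  case Nil
  show ?case by (simp add: word_equiv.refl)
next
  case (Cons a u)
  have "word_equiv R (rev (map letter_inv u) @ [letter_inv a, a] @ u) (rev (map letter_inv u) @ u)"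
    by (cases a) (auto intro: word_equiv.Gen_Inv[simplified] word_equiv.Inv_Gen[simplified])
  with Cons show ?case by (auto intro: word_equiv.trans)
qed

lemma group_presented_group: "group (presented_group R)"
proof (rule groupI)
  fix A assume "A \<in> carrier (presented_group R)"
  then obtain u where u: "A = word_class R u" by (auto simp: carrier_presented_group)
  have "word_class R (rev (map letter_inv u)) \<otimes>\<^bsub>presented_group R\<^esub> A = \<one>\<^bsub>presented_group R\<^esub>"
    by (simp add: u mult_presented_group one_presented_group word_class_eq_iff word_equiv_inv)
  then show "\<exists>B\<in>carrier (presented_group R). B \<otimes>\<^bsub>presented_group R\<^esub> A = \<one>\<^bsub>presented_group R\<^esub>"
    by (auto simp: carrier_presented_group)
qed (auto simp: carrier_presented_group mult_presented_group one_presented_group)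


section \<open>The dihedral group\<close>

datatype dihedral_gen = X | Y

definition dihedral_rels :: "nat \<Rightarrow> (dihedral_gen letter list \<times> dihedral_gen letter list) set" where
  "dihedral_rels n =
     {(replicate n (Gen X), []), ([Gen Y, Gen Y], []), ([Inv Y, Gen X, Gen Y], [Inv X])}"

text \<open>The argument \<open>n\<close> is half of the order: \<open>dihedral_group n\<close> is $D_{2n}$.\<close>

definition dihedral_group :: "nat \<Rightarrow> dihedral_gen letter list set monoid" where
  "dihedral_group n = presented_group (dihedral_rels n)"

lemma group_dihedral_group: "group (dihedral_group n)"
  by (simp add: dihedral_group_def group_presented_group)

fun dihedral_eval :: "dihedral_gen letter list \<Rightarrow> int \<times> bool" where
  "dihedral_eval [] = (0, False)"
| "dihedral_eval (Gen X # w) = (fst (dihedral_eval w) + 1, snd (dihedral_eval w))"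
| "dihedral_eval (Inv X # w) = (fst (dihedral_eval w) - 1, snd (dihedral_eval w))"
| "dihedral_eval (_ # w) = (- fst (dihedral_eval w), \<not> snd (dihedral_eval w))"

lemma dihedral_eval_append_cong:
  assumes "snd (dihedral_eval v) = snd (dihedral_eval w)"
    and "[fst (dihedral_eval v) = fst (dihedral_eval w)] (mod m)"
  shows "snd (dihedral_eval (u @ v)) = snd (dihedral_eval (u @ w)) \<and>
         [fst (dihedral_eval (u @ v)) = fst (dihedral_eval (u @ w))] (mod m)"
  using assms
  by (induction u rule: dihedral_eval.induct)
     (auto intro: cong_add cong_diff simp: cong_minus_minus_iff)

lemma dihedral_eval_replicate:
  "dihedral_eval (replicate i (Gen X) @ w) = (fst (dihedral_eval w) + int i, snd (dihedral_eval w))"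
  by (induction i) auto

lemma dihedral_eval_equiv:
  assumes "word_equiv (dihedral_rels n) u v"
  shows "snd (dihedral_eval u) = snd (dihedral_eval v) \<and>
         [fst (dihedral_eval u) = fst (dihedral_eval v)] (mod int n)"
  using assms
proof (induction rule: word_equiv.induct)
  case (Gen_Inv u g v)
  show ?case by (rule dihedral_eval_append_cong) (cases g; simp)+
next
  case (Inv_Gen u g v)
  show ?case by (rule dihedral_eval_append_cong) (cases g; simp)+
next
  case (rel l r u v)
  then show ?case
    by (intro dihedral_eval_append_cong)
       (auto simp: dihedral_rels_def dihedral_eval_replicate cong_def)
qed (auto intro: cong_sym cong_trans)

lemma dihedral_normal_form:
  assumes "n > 0"
  shows "\<exists>i<n. \<exists>j<2. word_equiv (dihedral_rels n) w (replicate i (Gen X) @ replicate j (Gen Y))"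
proof (induction w rule: rev_induct)
  case Nil
  show ?case using assms
    by (intro exI[of _ 0] conjI) (auto intro: word_equiv.refl)
next
  case (snoc a w)
  let ?x = "Gen X" and ?y = "Gen Y" and ?R = "dihedral_rels n"
  define eqv where "eqv = word_equiv (dihedral_rels n)"
  note tr[trans] = word_equiv.trans[of ?R, folded eqv_def]
  note ctx = word_equiv_append1[of ?R, folded eqv_def]
  note sm = word_equiv.sym[of ?R, folded eqv_def]
  note rf = word_equiv.refl[of ?R, folded eqv_def]
  note gi = word_equiv.Gen_Inv[of ?R, folded eqv_def]
  note ig = word_equiv.Inv_Gen[of ?R, folded eqv_def]
  have r1: "eqv (replicate n ?x) []"
    using word_equiv.rel[of "replicate n ?x" "[]" ?R "[]" "[]"] by (simp add: dihedral_rels_def eqv_def)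
  have r2: "eqv [?y, ?y] []"
    using word_equiv.rel[of "[?y, ?y]" "[]" ?R "[]" "[]"] by (simp add: dihedral_rels_def eqv_def)
  have r3: "eqv [Inv Y, ?x, ?y] [Inv X]"
    using word_equiv.rel[of "[Inv Y, ?x, ?y]" "[Inv X]" ?R "[]" "[]"]
    by (simp add: dihedral_rels_def eqv_def)
  have yi: "eqv [Inv Y] [?y]"
    using ig[of "[]" Y "[?y]"] sm[OF ctx[OF r2, of "[Inv Y]" "[]"]] by (auto intro: tr)
  have yx: "eqv [?y, ?x] [Inv X, ?y]"
  proof -
    have "eqv [?y, ?x] [?y, ?x, ?y, ?y]"
      using sm[OF ctx[OF r2, of "[?y, ?x]" "[]"]] by simp
    also have "eqv \<dots> [Inv Y, ?x, ?y, ?y]"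
      using sm[OF ctx[OF yi, of "[]" "[?x, ?y, ?y]"]] by simp
    also have "eqv \<dots> [Inv X, ?y]"
      using ctx[OF r3, of "[]" "[?y]"] by simp
    finally show ?thesis .
  qed
  have yX: "eqv [?y, Inv X] [?x, ?y]"
  proof -
    have "eqv [?y, Inv X] [?y, Inv Y, ?x, ?y]"
      using sm[OF ctx[OF r3, of "[?y]" "[]"]] by simp
    also have "eqv \<dots> [?x, ?y]"
      using gi[of "[]" Y "[?x, ?y]"] by simp
    finally show ?thesis .
  qed
  have up: "\<exists>k<n. eqv (replicate i ?x @ [?x]) (replicate k ?x)" if "i < n" for i
  proof (cases "Suc i = n")
    case True
    then show ?thesis using r1 assms
      by (intro exI[of _ 0]) (auto simp: replicate_append_same simp flip: replicate_Suc)
  next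
    case False
    then show ?thesis using that rf
      by (intro exI[of _ "Suc i"]) (auto simp: replicate_append_same)
  qed
  have down0: "eqv (replicate (Suc i) ?x @ [Inv X]) (replicate i ?x)" for i
  proof -
    have "replicate (Suc i) ?x @ [Inv X] = replicate i ?x @ [?x, Inv X] @ []"
      by (simp add: replicate_append_same[symmetric] flip: append_assoc)
    then show ?thesis using gi[of "replicate i ?x" X "[]"] by (simp del: replicate_Suc)
  qed
  have down: "\<exists>k<n. eqv (replicate i ?x @ [Inv X]) (replicate k ?x)" if "i < n" for i
  proof (cases i)
    case 0
    have "eqv [Inv X] (replicate n ?x @ [Inv X])"
      using sm[OF ctx[OF r1, of "[]" "[Inv X]"]] by simp
    also have "eqv \<dots> (replicate (n - 1) ?x)"
      using down0[of "n - 1"] assms by simp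
    finally show ?thesis using 0 assms by (intro exI[of _ "n - 1"]) auto
  next
    case (Suc k)
    then show ?thesis using down0[of k] that by (intro exI[of _ k]) auto
  qed
  from snoc obtain i j where ij: "i < n" "j < 2" and w: "eqv w (replicate i ?x @ replicate j ?y)"
    by (auto simp: eqv_def)
  have wa: "eqv (w @ [a]) (replicate i ?x @ replicate j ?y @ [a])"
    using ctx[OF w, of "[]" "[a]"] by simp
  have reduce: "\<exists>k<n. \<exists>l<2. eqv (w @ [a]) (replicate k ?x @ replicate l ?y)"
    if "eqv (replicate i ?x @ replicate j ?y @ [a]) (v @ replicate l ?y)" "l < 2"
      "\<exists>k<n. eqv v (replicate k ?x)" for v l
  proof -
    from that obtain k where k: "k < n" "eqv v (replicate k ?x)" by blast
    have "eqv (v @ replicate l ?y) (replicate k ?x @ replicate l ?y)"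
      using ctx[OF k(2), of "[]"] by simp
    with wa that(1,2) k(1) show ?thesis by (meson tr)
  qed
  have self: "\<exists>k<n. eqv (replicate i ?x) (replicate k ?x)"
    using ij rf by blast
  have y_last: "\<exists>k<n. \<exists>l<2. eqv (w @ [a]) (replicate k ?x @ replicate l ?y)"
    if a: "eqv [a] [?y]"
  proof (cases "j = 0")
    case True
    then show ?thesis
      using ctx[OF a, of "replicate i ?x" "[]"] by (intro reduce[of "replicate i ?x" 1] self) auto
  next
    case False
    then have j: "j = 1" using ij by simp
    have "eqv (replicate i ?x @ [?y, a]) (replicate i ?x @ [?y, ?y])"
      using ctx[OF a, of "replicate i ?x @ [?y]" "[]"] by simp
    also have "eqv \<dots> (replicate i ?x)"
      using ctx[OF r2, of "replicate i ?x" "[]"] by simp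
    finally show ?thesis using j by (intro reduce[of "replicate i ?x" 0] self) auto
  qed
  have "\<exists>k<n. \<exists>l<2. eqv (w @ [a]) (replicate k ?x @ replicate l ?y)"
  proof (cases a)
    case (Gen g)
    show ?thesis
    proof (cases g)
      case X
      show ?thesis
      proof (cases "j = 0")
        case True
        then show ?thesis using Gen X rf ij
          by (intro reduce[of "replicate i ?x @ [?x]" 0] up) auto
      next
        case False
        then have j: "j = 1" using ij by simp
        show ?thesis using Gen X j ij ctx[OF yx, of "replicate i ?x" "[]"]
          by (intro reduce[of "replicate i ?x @ [Inv X]" 1] down) auto
      qed
    next
      case Y
      then show ?thesis using Gen rf y_last by simp
    qed
  next
    case (Inv g)
    show ?thesis
    proof (cases g)
      case X
      show ?thesis
      proof (cases "j = 0")
        case True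
        then show ?thesis using Inv X rf ij
          by (intro reduce[of "replicate i ?x @ [Inv X]" 0] down) auto
      next
        case False
        then have j: "j = 1" using ij by simp
        show ?thesis using Inv X j ij ctx[OF yX, of "replicate i ?x" "[]"]
          by (intro reduce[of "replicate i ?x @ [?x]" 1] up) auto
      qed
    next
      case Y
      then show ?thesis using Inv yi y_last by simp
    qed
  qed
  then show ?case by (simp add: eqv_def)
qed

lemma order_dihedral_group:
  assumes "n > 0"
  shows "order (dihedral_group n) = 2 * n"
proof -
  let ?R = "dihedral_rels n"
  let ?f = "\<lambda>(i, j). word_class ?R (replicate i (Gen X) @ replicate j (Gen Y))"
  have "carrier (dihedral_group n) = ?f ` ({..<n} \<times> {..<2})"
  proof
    show "carrier (dihedral_group n) \<subseteq> ?f ` ({..<n} \<times> {..<2})"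
    proof
      fix A assume "A \<in> carrier (dihedral_group n)"
      then obtain w where w: "A = word_class ?R w"
        by (auto simp: dihedral_group_def carrier_presented_group)
      from dihedral_normal_form[OF assms, of w] obtain i j where
        "i < n" "j < 2" "A = ?f (i, j)" by (auto simp: w word_class_eq_iff)
      then show "A \<in> ?f ` ({..<n} \<times> {..<2})" by blast
    qed
  qed (auto simp: dihedral_group_def carrier_presented_group)
  moreover have "inj_on ?f ({..<n} \<times> {..<2})"
  proof (rule inj_onI, clarify)
    fix i j i' j' :: nat
    assume less: "i < n" "j < 2" "i' < n" "j' < 2"
      and "word_class ?R (replicate i (Gen X) @ replicate j (Gen Y)) =
           word_class ?R (replicate i' (Gen X) @ replicate j' (Gen Y))"
    then have "word_equiv ?R (replicate i (Gen X) @ replicate j (Gen Y))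
                 (replicate i' (Gen X) @ replicate j' (Gen Y))"
      by (simp add: word_class_eq_iff)
    from dihedral_eval_equiv[OF this]
    have *: "snd (dihedral_eval (replicate j (Gen Y))) = snd (dihedral_eval (replicate j' (Gen Y)))"
      "[fst (dihedral_eval (replicate j (Gen Y))) + int i =
        fst (dihedral_eval (replicate j' (Gen Y))) + int i'] (mod int n)"
      by (simp_all add: dihedral_eval_replicate)
    have "j \<in> {0, 1}" "j' \<in> {0, 1}" using less by auto
    with * have "j = j'" "[int i = int i'] (mod int n)" by auto
    with less show "i = i' \<and> j = j'" by (simp add: cong_def)
  qed
  ultimately show ?thesis
    by (simp add: order_def card_image)
qed

end

theory Submission
  imports Defs
begin

text \<open>
  A reflection of the dihedral group \<open>D\<close> is an involution outside the rotation subgroup \<open>C\<close>.  The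
  cyclic group that it generates has order two, so it contains no other non-identity element, and no
  rotation generates a group containing it.  Hence in the power graph every reflection is a pendant
  vertex, attached to the identity; on \<open>C\<close>, the power graph of \<open>D\<close> is that of \<open>C\<close>, because the
  subgroup generated by an element does not depend on the ambient group.

  Pendant vertices do not affect the number of spanning trees: a spanning tree must use the only edge
  at each of them (it is connected), and the remaining edges form a spanning tree of the rest.  This
  is \<open>card_spanning_tree_rel_pendant\<close>, where the point is that a cycle never visits a pendant
  vertex (\<open>edge_cycle_avoids_pendant\<close>).  Together they give
  \<open>kappa_eq_if_involutions_outside\<close> for any group in which all elements outside the image of an
  embedded group are involutions.

  For the presentation of \<open>D\<close> it remains to embed \<open>\<int>/n\<close> and to see the involutions.  Both follow by
  evaluating words, since two words represent the same element iff they have the same rotation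
  angle modulo \<open>n\<close> and the same orientation (\<open>word_equiv_dihedral_iff\<close>).
\<close>

section \<open>Spanning trees as relations\<close>

text \<open>
  The spanning trees of a graph of pairs are determined by their arcs.  Working with the sets of
  arcs makes it possible to transport them along maps of vertices.
\<close>

definition edge_cycle :: "'a rel \<Rightarrow> ('a \<times> 'a) list \<Rightarrow> bool" where
  "edge_cycle A p \<longleftrightarrow> set p \<subseteq> A \<and> (\<exists>u. pcas u p u) \<and> distinct (map snd p) \<and> 3 \<le> length p"

definition spanning_tree_rel :: "'a set \<Rightarrow> 'a rel \<Rightarrow> bool" where
  "spanning_tree_rel V A \<longleftrightarrow> sym A \<and> V \<times> V \<subseteq> A\<^sup>* \<and> (\<nexists>p. edge_cycle A p)"

lemma pawalk_verts_eq: "pcas u p v \<Longrightarrow> pawalk_verts u p = u # map snd p"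
  by (induction p arbitrary: u) auto

lemma cycle_iff_edge_cycle:
  assumes "pair_wf_digraph P"
  shows "pre_digraph.cycle (with_proj P) p \<and> 3 \<le> length p \<longleftrightarrow> edge_cycle (parcs P) p"
proof -
  interpret pair_wf_digraph P by fact
  have "u \<in> pverts P" if "pcas u p u" "set p \<subseteq> parcs P" "p \<noteq> []" for u
    using that arc_fst_in_verts by (cases p) force+
  moreover have "p \<noteq> []" if "3 \<le> length p"
    using that by auto
  ultimately show ?thesis
    unfolding cycle_def edge_cycle_def awalk_def by (metis list.sel(3) pawalk_verts_eq)
qed

lemma undirected_spanning_tree_iff:
  assumes P: "pair_wf_digraph P" and ne: "pverts P \<noteq> {}"
  shows "undirected_spanning_tree T (with_proj P) \<longleftrightarrow>
    (\<exists>A\<subseteq>parcs P. spanning_tree_rel (pverts P) A \<and> T = with_proj \<lparr>pverts = pverts P, parcs = A\<rparr>)"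
proof -
  have wfP: "wf_digraph (with_proj P)"
    using P by (simp add: pair_wf_digraph_def wf_digraph_def)
  have sub: "spanning T (with_proj P) \<longleftrightarrow>
    (\<exists>A\<subseteq>parcs P. T = with_proj \<lparr>pverts = pverts P, parcs = A\<rparr>)"
  proof
    assume "spanning T (with_proj P)"
    then show "\<exists>A\<subseteq>parcs P. T = with_proj \<lparr>pverts = pverts P, parcs = A\<rparr>"
      by (intro exI[of _ "arcs T"])
         (auto simp: spanning_def subgraph_def compatible_def with_proj_def)
  next
    assume "\<exists>A\<subseteq>parcs P. T = with_proj \<lparr>pverts = pverts P, parcs = A\<rparr>"
    then show "spanning T (with_proj P)"
      using wfP by (fastforce simp: spanning_def subgraph_def compatible_def wf_digraph_def)
  qed
  have "symmetric T \<and> Digraph_Component.connected T \<and> \<not> (\<exists>p. pre_digraph.cycle T p \<and> 3 \<le> length p)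
      \<longleftrightarrow> spanning_tree_rel (pverts P) A"
    if A: "A \<subseteq> parcs P" and T: "T = with_proj \<lparr>pverts = pverts P, parcs = A\<rparr>" for A
  proof -
    have wfQ: "pair_wf_digraph \<lparr>pverts = pverts P, parcs = A\<rparr>"
      using P A by (fastforce simp: pair_wf_digraph_def)
    interpret T: wf_digraph T
      using wfQ by (auto simp: T pair_wf_digraph_def wf_digraph_def)
    have "symmetric T \<longleftrightarrow> sym A"
      by (simp add: symmetric_def T)
    moreover have "Digraph_Component.connected T \<longleftrightarrow> pverts P \<times> pverts P \<subseteq> A\<^sup>*" if "symmetric T"
      using T.reachable_mk_symmetric_eq[OF that] ne
      by (auto simp: Digraph_Component.connected_def strongly_connected_def T.reachable_conv)
         (auto simp: T)
    ultimately show ?thesis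
      using cycle_iff_edge_cycle[OF wfQ] by (auto simp: spanning_tree_rel_def T)
  qed
  with sub show ?thesis
    unfolding undirected_spanning_tree_def by blast
qed

lemma card_undirected_spanning_trees:
  assumes "pair_wf_digraph P" "pverts P \<noteq> {}"
  shows "card {T. undirected_spanning_tree T (with_proj P)} =
    card {A. A \<subseteq> parcs P \<and> spanning_tree_rel (pverts P) A}"
proof -
  let ?T = "\<lambda>A. with_proj \<lparr>pverts = pverts P, parcs = A\<rparr>"
  have "{T. undirected_spanning_tree T (with_proj P)} =
      ?T ` {A. A \<subseteq> parcs P \<and> spanning_tree_rel (pverts P) A}"
    using undirected_spanning_tree_iff[OF assms] by auto
  moreover have "inj ?T"
    by (rule injI) (simp add: with_proj_def)
  ultimately show ?thesis
    by (simp add: card_image inj_on_subset)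
qed


section \<open>Pendant vertices\<close>

lemma pcas_append: "pcas u (p @ q) v \<longleftrightarrow> (\<exists>w. pcas u p w \<and> pcas w q v)"
  by (induction p arbitrary: u) auto

lemma pcas_last: "pcas u p v \<Longrightarrow> p \<noteq> [] \<Longrightarrow> snd (last p) = v"
  by (induction p arbitrary: u) auto

lemma pcas_map: "pcas u p v \<Longrightarrow> pcas (h u) (map (map_prod h h) p) (h v)"
  by (induction p arbitrary: u) auto

lemma edge_cycle_rotate:
  assumes "edge_cycle A p" "e \<in> set p"
  obtains q where "edge_cycle A (e # q)" "set (e # q) = set p"
proof -
  from assms(2) obtain xs ys where p: "p = xs @ e # ys"
    by (meson split_list)
  from assms(1) obtain u where "pcas u (xs @ e # ys) u"
    by (auto simp: edge_cycle_def p)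
  then have "pcas (fst e) ((e # ys) @ xs) (fst e)"
    unfolding pcas_append by auto
  with assms(1) have "edge_cycle A (e # ys @ xs)"
    by (auto simp: edge_cycle_def p)
  then show ?thesis
    by (rule that) (auto simp: p)
qed

lemma edge_cycle_map:
  assumes "edge_cycle A p" "inj_on h (snd ` A)" "map_prod h h ` A \<subseteq> B"
  shows "edge_cycle B (map (map_prod h h) p)"
proof -
  have "inj_on h (snd ` set p)"
    using assms(1,2) by (auto simp: edge_cycle_def intro: inj_on_subset)
  moreover have "map snd (map (map_prod h h) p) = map h (map snd p)"
    by simp
  ultimately have "distinct (map snd (map (map_prod h h) p))"
    using assms(1) by (simp only: distinct_map[of h] edge_cycle_def list.set_map)
  then show ?thesis
    using assms pcas_map[of _ p _ h] by (fastforce simp: edge_cycle_def)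
qed

text \<open>
  A cycle through \<open>v\<close> enters it from its only neighbour \<open>r\<close> and has to return to \<open>r\<close>.  Since it
  visits \<open>r\<close> only once, it has length two.
\<close>

lemma edge_cycle_avoids_pendant:
  assumes cyc: "edge_cycle A p"
    and pendant: "\<And>x. (x, v) \<in> A \<Longrightarrow> x = r" "\<And>x. (v, x) \<in> A \<Longrightarrow> x = r"
    and e: "e \<in> set p"
  shows "fst e \<noteq> v" "snd e \<noteq> v"
proof -
  have snd: "snd e \<noteq> v" if "e \<in> set p" for e
  proof
    assume v: "snd e = v"
    from cyc that obtain q where q: "edge_cycle A (e # q)"
      by (rule edge_cycle_rotate)
    then have e: "e = (r, v)"
      using v pendant(1)[of "fst e"] by (cases e) (auto simp: edge_cycle_def)
    with q have "pcas v q r" "2 \<le> length q" "set q \<subseteq> A" "distinct (map snd q)"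
      by (auto simp: edge_cycle_def)
    moreover from this obtain x q' where q': "q = (v, x) # q'" "q' \<noteq> []"
      by (cases q) (auto simp: Suc_le_eq)
    ultimately have "x = r" "pcas x q' r" "x \<notin> snd ` set q'"
      using pendant(2) by auto
    with q'(2) show False
      using pcas_last[of x q' r] last_in_set[of q'] by force
  qed
  show "snd e \<noteq> v"
    using e by (rule snd)
  show "fst e \<noteq> v"
  proof
    assume v: "fst e = v"
    from cyc e obtain q where q: "edge_cycle A (e # q)" "set (e # q) = set p"
      by (rule edge_cycle_rotate)
    then have "pcas v (e # q) v"
      using v by (auto simp: edge_cycle_def)
    then have "snd (last (e # q)) = v"
      by (rule pcas_last) simp
    moreover have "last (e # q) \<in> set p"
      unfolding q(2)[symmetric] by (rule last_in_set) simp
    ultimately show False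
      using snd by blast
  qed
qed

lemma rtrancl_map_prod:
  assumes "(u, v) \<in> A\<^sup>*" "\<And>x y. (x, y) \<in> A \<Longrightarrow> (h x, h y) \<in> B\<^sup>*"
  shows "(h u, h v) \<in> B\<^sup>*"
  using assms(1) by induction (auto intro: rtrancl_trans assms(2))

text \<open>
  Paths and cycles are pushed forward along \<open>f\<close> and pulled back along its left inverse \<open>g\<close> that
  sends the pendant vertices to \<open>r\<close>.  A path step along a pendant edge is collapsed by \<open>g\<close>, and a
  cycle contains no such step.
\<close>

lemma spanning_tree_rel_pendant_iff:
  assumes inj: "inj_on f V" and r: "r \<in> V" and P: "P \<inter> f ` V = {}" and B: "B \<subseteq> V \<times> V"
  shows "spanning_tree_rel (f ` V \<union> P) (map_prod f f ` B \<union> {f r} \<times> P \<union> P \<times> {f r}) \<longleftrightarrow>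
    spanning_tree_rel V B" (is "spanning_tree_rel ?W ?A \<longleftrightarrow> _")
proof -
  define g where "g y = (if y \<in> P then r else the_inv_into V f y)" for y
  have g_f: "g (f x) = x" if "x \<in> V" for x
    using that P inj by (auto simp: g_def the_inv_into_f_f)
  have g_P: "g y = r" if "y \<in> P" for y
    using that by (simp add: g_def)
  have A_f: "(x, y) \<in> B" if "(f x, f y) \<in> ?A" "x \<in> V" "y \<in> V" for x y
    using that P B inj by (auto simp: subset_iff inj_on_eq_iff)
  have "sym ?A \<longleftrightarrow> sym B"
  proof
    assume A: "sym ?A"
    show "sym B"
    proof (rule symI)
      fix x y assume xy: "(x, y) \<in> B"
      then have "(f x, f y) \<in> ?A"
        by force
      with A have "(f y, f x) \<in> ?A"
        by (rule symD)
      with xy B show "(y, x) \<in> B"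
        by (intro A_f) auto
    qed
  qed (auto simp: sym_def)
  moreover have "?W \<times> ?W \<subseteq> ?A\<^sup>* \<longleftrightarrow> V \<times> V \<subseteq> B\<^sup>*"
  proof
    assume A: "?W \<times> ?W \<subseteq> ?A\<^sup>*"
    have "(g x, g y) \<in> B\<^sup>*" if "(x, y) \<in> ?A" for x y
      using that B r by (auto simp: g_f g_P)
    with A have *: "(g x, g y) \<in> B\<^sup>*" if "x \<in> ?W" "y \<in> ?W" for x y
      using that by (intro rtrancl_map_prod[of x y ?A g]) auto
    have "(x, y) \<in> B\<^sup>*" if "x \<in> V" "y \<in> V" for x y
      using *[of "f x" "f y"] that by (simp add: g_f)
    then show "V \<times> V \<subseteq> B\<^sup>*"
      by auto
  next
    assume B: "V \<times> V \<subseteq> B\<^sup>*"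
    have "(f x, f y) \<in> ?A\<^sup>*" if "x \<in> V" "y \<in> V" for x y
      using B that by (intro rtrancl_map_prod[of x y B f]) auto
    then have "(x, f r) \<in> ?A\<^sup>*" "(f r, x) \<in> ?A\<^sup>*" if "x \<in> ?W" for x
      using that r by auto
    then show "?W \<times> ?W \<subseteq> ?A\<^sup>*"
      by (auto intro: rtrancl_trans)
  qed
  moreover have "(\<exists>p. edge_cycle ?A p) \<longleftrightarrow> (\<exists>p. edge_cycle B p)"
  proof
    assume "\<exists>p. edge_cycle ?A p"
    then obtain p where p: "edge_cycle ?A p" ..
    have "fst e \<notin> P \<and> snd e \<notin> P" if "e \<in> set p" for e
    proof -
      have "x = f r" if "v \<in> P" "(x, v) \<in> ?A \<or> (v, x) \<in> ?A" for x v
        using that P B r by auto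
      then show ?thesis
        using edge_cycle_avoids_pendant[OF p _ _ that, where r = "f r"] by metis
    qed
    with p have p: "edge_cycle (map_prod f f ` B) p"
      unfolding edge_cycle_def by fastforce
    have "inj_on g (f ` V)"
      by (auto simp: inj_on_def g_f)
    then have "inj_on g (snd ` map_prod f f ` B)"
      by (rule inj_on_subset) (use B in auto)
    moreover have "map_prod g g ` map_prod f f ` B \<subseteq> B"
      using B by (auto simp: g_f)
    ultimately show "\<exists>p. edge_cycle B p"
      using edge_cycle_map[OF p] by blast
  next
    assume "\<exists>p. edge_cycle B p"
    moreover have "inj_on f (snd ` B)"
      using inj by (rule inj_on_subset) (use B in auto)
    ultimately show "\<exists>p. edge_cycle ?A p"
      by (metis edge_cycle_map sup.coboundedI1 sup_ge1)
  qed
  ultimately show ?thesis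
    by (simp add: spanning_tree_rel_def)
qed

theorem card_spanning_tree_rel_pendant:
  fixes f :: "'a \<Rightarrow> 'b"
  assumes inj: "inj_on f V" and r: "r \<in> V" and P: "P \<inter> f ` V = {}" and F: "F \<subseteq> V \<times> V"
  shows "card {A. A \<subseteq> map_prod f f ` F \<union> {f r} \<times> P \<union> P \<times> {f r} \<and> spanning_tree_rel (f ` V \<union> P) A} =
    card {B. B \<subseteq> F \<and> spanning_tree_rel V B}"
proof -
  let ?S = "{f r} \<times> P \<union> P \<times> {f r}"
  let ?\<Phi> = "\<lambda>B. map_prod f f ` B \<union> {f r} \<times> P \<union> P \<times> {f r}"
  have inj2: "inj_on (map_prod f f) (V \<times> V)"
    using inj by (simp add: map_prod_inj_on)
  have disj: "map_prod f f ` B \<inter> ?S = {}" if "B \<subseteq> F" for B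
    using that F P by auto
  have "inj_on ?\<Phi> {B. B \<subseteq> F \<and> spanning_tree_rel V B}"
  proof (rule inj_onI, clarify)
    fix B C assume BC: "B \<subseteq> F" "C \<subseteq> F" and "?\<Phi> B = ?\<Phi> C"
    then have "map_prod f f ` B \<union> ?S = map_prod f f ` C \<union> ?S"
      by (simp only: Un_assoc)
    moreover have "M = N" if "M \<union> S = N \<union> S" "M \<inter> S = {}" "N \<inter> S = {}"
      for M N S :: "('b \<times> 'b) set"
      using that by blast
    ultimately have "map_prod f f ` B = map_prod f f ` C"
      using disj BC by simp
    with inj2 show "B = C"
      using BC F by (meson inj_on_image_eq_iff subset_trans)
  qed
  moreover have "?\<Phi> ` {B. B \<subseteq> F \<and> spanning_tree_rel V B} =
      {A. A \<subseteq> ?\<Phi> F \<and> spanning_tree_rel (f ` V \<union> P) A}" (is "?L = ?R")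
  proof
    show "?L \<subseteq> ?R"
      using spanning_tree_rel_pendant_iff[OF inj r P] F by blast
    show "?R \<subseteq> ?L"
    proof
      fix A assume "A \<in> ?R"
      then have A: "A \<subseteq> ?\<Phi> F" and tree: "spanning_tree_rel (f ` V \<union> P) A"
        by auto
      \<comment> \<open>The last step of a path from \<open>f r\<close> to a pendant vertex uses the only edge there.\<close>
      have S: "(f r, v) \<in> A \<and> (v, f r) \<in> A" if v: "v \<in> P" for v
      proof -
        have "(f r, v) \<in> A\<^sup>*" "f r \<noteq> v"
          using tree v r P by (auto simp: spanning_tree_rel_def)
        then obtain x where x: "(x, v) \<in> A"
          by (metis rtranclE)
        then have "x = f r"
          using A v P F r by auto
        with x tree show ?thesis
          by (auto simp: spanning_tree_rel_def dest: symD)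
      qed
      obtain B where B: "B \<subseteq> F" "A \<inter> map_prod f f ` F = map_prod f f ` B"
        by (metis inf_le2 subset_image_iff)
      have "A = ?\<Phi> B"
        using A S unfolding B(2)[symmetric] by blast
      moreover from this have "spanning_tree_rel V B"
        using spanning_tree_rel_pendant_iff[OF inj r P, of B] tree B F by auto
      ultimately show "A \<in> ?L"
        using B(1) by blast
    qed
  qed
  ultimately show ?thesis
    by (metis (no_types, lifting) card_image)
qed


section \<open>Power graphs\<close>

definition power_rel :: "('a, 'm) monoid_scheme \<Rightarrow> 'a rel" where
  "power_rel G = {(x, y). x \<in> carrier G \<and> y \<in> carrier G \<and> x \<noteq> y \<and>
     (generate G {x} \<subseteq> generate G {y} \<or> generate G {y} \<subseteq> generate G {x})}"

lemma kappa_eq_card_spanning_tree_rel: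
  assumes "group G"
  shows "\<kappa> G = card {A. A \<subseteq> power_rel G \<and> spanning_tree_rel (carrier G) A}"
proof -
  interpret group G by fact
  have "power_graph G = with_proj \<lparr>pverts = carrier G, parcs = power_rel G\<rparr>"
    by (simp add: power_graph_def power_rel_def)
  moreover have "pair_wf_digraph \<lparr>pverts = carrier G, parcs = power_rel G\<rparr>"
    by (auto simp: pair_wf_digraph_def power_rel_def)
  ultimately show ?thesis
    using card_undirected_spanning_trees[of "\<lparr>pverts = carrier G, parcs = power_rel G\<rparr>"]
    by (auto simp: kappa_def)
qed

lemma (in group) generate_involution:
  assumes "x \<in> carrier G" "x \<otimes> x = \<one>"
  shows "generate G {x} = {\<one>, x}"
proof
  have inv: "inv x = x"
    using assms by (simp add: inv_equality)
  show "generate G {x} \<subseteq> {\<one>, x}"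
  proof
    fix y assume "y \<in> generate G {x}"
    then show "y \<in> {\<one>, x}"
      by induction (use assms inv in auto)
  qed
qed (auto intro: generate.intros)

text \<open>
  If \<open>x \<in> P\<close>, then \<open>{\<one>, x}\<close> contains the cyclic group of \<open>y \<noteq> x\<close> only for \<open>y = \<one>\<close>.  It is
  contained in the cyclic group of \<open>y\<close> neither for \<open>y\<close> in the image of \<open>f\<close>, which is a subgroup
  avoiding \<open>x\<close>, nor for another \<open>y \<in> P\<close>, whose cyclic group is \<open>{\<one>, y}\<close>.
\<close>

lemma power_rel_involutions_outside:
  assumes "group_hom G D f" and inj: "inj_on f (carrier G)"
    and invol: "\<And>x. x \<in> carrier D - f ` carrier G \<Longrightarrow> x \<otimes>\<^bsub>D\<^esub> x = \<one>\<^bsub>D\<^esub>"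
    and P: "P = carrier D - f ` carrier G"
  shows "power_rel D = map_prod f f ` power_rel G \<union>
    {f \<one>\<^bsub>G\<^esub>} \<times> P \<union> P \<times> {f \<one>\<^bsub>G\<^esub>}"
proof -
  interpret group_hom G D f by fact
  have gen_f: "generate D {f x} = f ` generate G {x}" if "x \<in> carrier G" for x
    using generate_img[of "{x}"] that by simp
  have gen_sub: "generate G {x} \<subseteq> carrier G" if "x \<in> carrier G" for x
    using G.generate_incl[of "{x}"] that by simp
  have gen_P: "generate D {x} = {\<one>\<^bsub>D\<^esub>, x}" if "x \<in> P" for x
    using that invol by (intro H.generate_involution) (auto simp: P)
  have one: "\<one>\<^bsub>D\<^esub> \<notin> P"
    unfolding P using hom_one by force
  have rot: "(f x, f y) \<in> power_rel D \<longleftrightarrow> (x, y) \<in> power_rel G"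
    if "x \<in> carrier G" "y \<in> carrier G" for x y
  proof -
    have "f ` A \<subseteq> f ` B \<longleftrightarrow> A \<subseteq> B" if "A \<subseteq> carrier G" "B \<subseteq> carrier G" for A B
      using that inj by (auto simp: inj_on_def subset_iff image_iff) metis
    with that show ?thesis
      using gen_sub inj by (simp add: power_rel_def gen_f inj_on_eq_iff)
  qed
  have refl: "(x, y) \<in> power_rel D \<longleftrightarrow> y = \<one>\<^bsub>D\<^esub>" "(y, x) \<in> power_rel D \<longleftrightarrow> y = \<one>\<^bsub>D\<^esub>"
    if x: "x \<in> P" and y: "y \<in> carrier D" for x y
  proof -
    have comparable: "generate D {x} \<subseteq> generate D {y} \<or> generate D {y} \<subseteq> generate D {x} \<longleftrightarrow>
        y = \<one>\<^bsub>D\<^esub>" if "x \<noteq> y"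
    proof
      assume *: "generate D {x} \<subseteq> generate D {y} \<or> generate D {y} \<subseteq> generate D {x}"
      show "y = \<one>\<^bsub>D\<^esub>"
      proof (cases "y \<in> P")
        case True
        with * that one x show ?thesis by (auto simp: gen_P)
      next
        case False
        then obtain z where z: "z \<in> carrier G" "y = f z"
          using y by (auto simp: P)
        then have "x \<notin> generate D {y}"
          using x gen_f[OF z(1)] gen_sub[OF z(1)] by (auto simp: P)
        moreover have "y \<in> generate D {y}"
          by (auto intro: generate.intros)
        ultimately show ?thesis
          using * x that by (auto simp: gen_P)
      qed
    next
      assume "y = \<one>\<^bsub>D\<^esub>"
      then have "generate D {y} = {\<one>\<^bsub>D\<^esub>}"
        using H.generate_involution[of y] by simp
      then show "generate D {x} \<subseteq> generate D {y} \<or> generate D {y} \<subseteq> generate D {x}"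
        using x by (simp add: gen_P)
    qed
    then show "(x, y) \<in> power_rel D \<longleftrightarrow> y = \<one>\<^bsub>D\<^esub>" "(y, x) \<in> power_rel D \<longleftrightarrow> y = \<one>\<^bsub>D\<^esub>"
      using x y one by (auto simp: power_rel_def P)
  qed
  have carD: "carrier D = f ` carrier G \<union> P"
    by (auto simp: P)
  have sub: "power_rel D \<subseteq> carrier D \<times> carrier D" "power_rel G \<subseteq> carrier G \<times> carrier G"
    by (auto simp: power_rel_def)
  have "(a, b) \<in> power_rel D \<longleftrightarrow>
      (a, b) \<in> map_prod f f ` power_rel G \<union> {f \<one>\<^bsub>G\<^esub>} \<times> P \<union> P \<times> {f \<one>\<^bsub>G\<^esub>}" for a b
  proof (cases "a \<in> P \<or> b \<in> P")
    case True
    then have "(a, b) \<notin> map_prod f f ` power_rel G"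
      using sub(2) by (auto simp: P)
    with True show ?thesis
      using refl one sub(1) by (auto simp: P)
  next
    case False
    show ?thesis
    proof
      assume "(a, b) \<in> power_rel D"
      with False sub(1) obtain x y where "x \<in> carrier G" "y \<in> carrier G" "a = f x" "b = f y"
        by (auto simp: carD)
      with rot \<open>(a, b) \<in> power_rel D\<close>
      show "(a, b) \<in> map_prod f f ` power_rel G \<union> {f \<one>\<^bsub>G\<^esub>} \<times> P \<union> P \<times> {f \<one>\<^bsub>G\<^esub>}"
        by auto
    next
      assume "(a, b) \<in> map_prod f f ` power_rel G \<union> {f \<one>\<^bsub>G\<^esub>} \<times> P \<union> P \<times> {f \<one>\<^bsub>G\<^esub>}"
      with False obtain x y where "(x, y) \<in> power_rel G" "a = f x" "b = f y"
        by auto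
      with rot sub(2) show "(a, b) \<in> power_rel D"
        by blast
    qed
  qed
  then show ?thesis
    by auto
qed

theorem kappa_eq_if_involutions_outside:
  assumes hom: "group_hom G D f" and inj: "inj_on f (carrier G)"
    and invol: "\<And>x. x \<in> carrier D - f ` carrier G \<Longrightarrow> x \<otimes>\<^bsub>D\<^esub> x = \<one>\<^bsub>D\<^esub>"
  shows "\<kappa> D = \<kappa> G"
proof -
  interpret group_hom G D f by fact
  let ?P = "carrier D - f ` carrier G"
  have pow: "power_rel D = map_prod f f ` power_rel G \<union> {f \<one>\<^bsub>G\<^esub>} \<times> ?P \<union> ?P \<times> {f \<one>\<^bsub>G\<^esub>}"
    using assms by (rule power_rel_involutions_outside) simp_all
  have carD: "f ` carrier G \<union> ?P = carrier D"
    by auto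
  have "\<kappa> D = card {A. A \<subseteq> power_rel D \<and> spanning_tree_rel (f ` carrier G \<union> ?P) A}"
    unfolding carD by (rule kappa_eq_card_spanning_tree_rel[OF H.is_group])
  also have "\<dots> = card {B. B \<subseteq> power_rel G \<and> spanning_tree_rel (carrier G) B}"
    unfolding pow
    by (rule card_spanning_tree_rel_pendant[OF inj G.one_closed]) (auto simp: power_rel_def)
  also have "\<dots> = \<kappa> G"
    by (rule kappa_eq_card_spanning_tree_rel[OF G.is_group, symmetric])
  finally show ?thesis .
qed


section \<open>The dihedral group\<close>

text \<open>Every word is equivalent to a normal form, and the evaluation separates the normal forms.\<close>

lemma word_equiv_dihedral_iff:
  assumes "n > 0"
  shows "word_equiv (dihedral_rels n) u v \<longleftrightarrow>
    snd (dihedral_eval u) = snd (dihedral_eval v) \<and>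
    [fst (dihedral_eval u) = fst (dihedral_eval v)] (mod int n)"
proof
  assume *: "snd (dihedral_eval u) = snd (dihedral_eval v) \<and>
    [fst (dihedral_eval u) = fst (dihedral_eval v)] (mod int n)"
  obtain i j where u: "i < n" "j < 2"
    "word_equiv (dihedral_rels n) u (replicate i (Gen X) @ replicate j (Gen Y))"
    using dihedral_normal_form[OF assms, of u] by blast
  obtain i' j' where v: "i' < n" "j' < 2"
    "word_equiv (dihedral_rels n) v (replicate i' (Gen X) @ replicate j' (Gen Y))"
    using dihedral_normal_form[OF assms, of v] by blast
  have j: "j \<in> {0, 1}" "j' \<in> {0, 1}"
    using u v by auto
  note eval = dihedral_eval_equiv[OF u(3)] dihedral_eval_equiv[OF v(3)]
  have "j = j'"
    using eval * j by (auto simp: dihedral_eval_replicate)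
  moreover from this have "[int i = int i'] (mod int n)"
    using eval * j by (auto simp: dihedral_eval_replicate cong_def)
  then have "i = i'"
    using u v by (simp add: cong_def)
  ultimately show "word_equiv (dihedral_rels n) u v"
    using u(3) v(3) by (auto intro: word_equiv.intros)
qed (rule dihedral_eval_equiv)

definition rotation :: "nat \<Rightarrow> int \<Rightarrow> dihedral_gen letter list set" where
  "rotation n k = word_class (dihedral_rels n) (replicate (nat k) (Gen X))"

lemma dihedral_eval_rotation_word:
  "dihedral_eval (replicate i (Gen X)) = (int i, False)"
  using dihedral_eval_replicate[of i "[]"] by simp

lemma group_hom_rotation:
  assumes "n > 0"
  shows "group_hom (integer_mod_group n) (dihedral_group n) (rotation n)"
proof -
  have "rotation n k \<in> carrier (dihedral_group n)" for k
    by (simp add: rotation_def dihedral_group_def carrier_presented_group)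
  moreover have "rotation n ((k + l) mod int n) = rotation n k \<otimes>\<^bsub>dihedral_group n\<^esub> rotation n l"
    if "k \<ge> 0" "l \<ge> 0" for k l
    using that assms
    by (simp add: rotation_def dihedral_group_def mult_presented_group word_class_eq_iff
        word_equiv_dihedral_iff dihedral_eval_rotation_word cong_def flip: replicate_add)
  ultimately show ?thesis
    using assms
    by (intro group_hom.intro group_hom_axioms.intro homI)
       (auto simp: group_dihedral_group carrier_integer_mod_group)
qed

lemma inj_on_rotation:
  assumes "n > 0"
  shows "inj_on (rotation n) (carrier (integer_mod_group n))"
  using assms
  by (auto simp: inj_on_def carrier_integer_mod_group rotation_def word_class_eq_iff
      word_equiv_dihedral_iff dihedral_eval_rotation_word cong_def)

lemma reflection_involution:
  assumes "n > 0"
    and x: "x \<in> carrier (dihedral_group n) - rotation n ` carrier (integer_mod_group n)"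
  shows "x \<otimes>\<^bsub>dihedral_group n\<^esub> x = \<one>\<^bsub>dihedral_group n\<^esub>"
proof -
  from x obtain w where w: "x = word_class (dihedral_rels n) w"
    by (auto simp: dihedral_group_def carrier_presented_group)
  from dihedral_normal_form[OF assms(1), of w] obtain i j where ij: "i < n" "j < 2"
    and w': "x = word_class (dihedral_rels n) (replicate i (Gen X) @ replicate j (Gen Y))"
    by (auto simp: w word_class_eq_iff)
  have "j \<noteq> 0"
  proof
    assume "j = 0"
    then have "x = rotation n (int i)"
      by (simp add: w' rotation_def)
    with x ij show False
      by (auto simp: carrier_integer_mod_group)
  qed
  with ij have "x = word_class (dihedral_rels n) (replicate i (Gen X) @ [Gen Y])"
    by (simp add: w' less_2_cases_iff)
  then show ?thesis
    using assms(1)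
    by (simp add: dihedral_group_def mult_presented_group one_presented_group word_class_eq_iff
        word_equiv_dihedral_iff dihedral_eval_replicate)
qed

theorem mainTheorem4:
  fixes n :: nat
  assumes "n > 0"
  shows "\<kappa> (dihedral_group n) = \<kappa> (integer_mod_group n)"
  using group_hom_rotation[OF assms] inj_on_rotation[OF assms] reflection_involution[OF assms]
  by (rule kappa_eq_if_involutions_outside)

end
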